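(* Let $\Omega_1,\Omega_2\subseteq\mathbb{C}$ be open. Given $f:\Omega_2\to\mathbb{C}$ holomorphic with only simple zeros, $g:\Omega_1\to\mathbb{C}$, and any points $z_0\in\Omega_1$, $w_0\in\Omega_2$, if there is a continuous function $G:\Omega_1\to\mathbb{C}$ such that $\frac{\partial G}{\partial\bar z}=g(z)$ on $\Omega_1$, then there exists a non-constant, continuous function $u:\Omega_1^0\to\Omega_2$ on some neighborhood $\Omega_1^0\subseteq\Omega_1$ of $z_0$, such that $\frac{\partial u}{\partial\bar z}=f(u)g(z)$ on $\Omega_1^0$ and $u(z_0)=w_0$.
   Context: Write $z=x+iy$. For a complex valued function $v$ on an open subset of $\mathbb{C}=\mathbb{R}^2$, $v_x,v_y$ denote the pointwise classical partial derivatives, and at points where both exist, $\frac{\partial v}{\partial\bar z}=\frac12(v_x+iv_y)$. An equation for $\frac{\partial v}{\partial\bar z}$ on a set includes the assertion that $v_x$ and $v_y$ exist at every point of that set. Neighborhoods are open. *)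

theory Defs
  imports "HOL-Complex_Analysis.Complex_Analysis"
begin

definition partial_x :: "(complex \<Rightarrow> complex) \<Rightarrow> complex \<Rightarrow> complex" where
  "partial_x v z = vector_derivative (\<lambda>t::real. v (z + of_real t)) (at 0)"

definition partial_y :: "(complex \<Rightarrow> complex) \<Rightarrow> complex \<Rightarrow> complex" where
  "partial_y v z = vector_derivative (\<lambda>t::real. v (z + \<i> * of_real t)) (at 0)"

definition has_partials_at :: "(complex \<Rightarrow> complex) \<Rightarrow> complex \<Rightarrow> bool" where
  "has_partials_at v z \<longleftrightarrow>
     (\<lambda>t::real. v (z + of_real t)) differentiable (at 0) \<and>
     (\<lambda>t::real. v (z + \<i> * of_real t)) differentiable (at 0)"

definition dbar :: "(complex \<Rightarrow> complex) \<Rightarrow> complex \<Rightarrow> complex" where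
  "dbar v z = (partial_x v z + \<i> * partial_y v z) / 2"

(* Used only for open S, so the partial derivatives at points of S do not depend on
   the values of v outside S. Existence of the partial derivatives is part of the
   equation: vector_derivative is total. *)
definition dbar_eq_on :: "(complex \<Rightarrow> complex) \<Rightarrow> (complex \<Rightarrow> complex) \<Rightarrow> complex set \<Rightarrow> bool" where
  "dbar_eq_on v h S \<longleftrightarrow> (\<forall>z\<in>S. has_partials_at v z \<and> dbar v z = h z)"

(* isolated_zero is needed because zorder is unspecified where f vanishes identically
   near w; isolated_zero alone does not constrain the value f w. *)
definition simple_zero :: "(complex \<Rightarrow> complex) \<Rightarrow> complex \<Rightarrow> bool" where
  "simple_zero f w \<longleftrightarrow> f w = 0 \<and> isolated_zero f w \<and> zorder f w = 1"

end

theory Submission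
  imports Defs
begin

text \<open>
  A holomorphic change of the unknown makes the semilinear equation trivial. If
  \<open>\<psi>\<close> is injective and holomorphic near \<open>w\<^sub>0\<close> and \<open>\<psi>' f = c \<circ> \<psi>\<close>, that is, if \<open>\<psi>\<close> carries
  the holomorphic vector field \<open>f\<close> to the vector field \<open>c\<close>, then by the chain rule
  \<open>u = \<psi>\<inverse> \<circ> S\<close> solves \<open>\<partial>u/\<partial>zbar = f(u) g\<close> as soon as \<open>\<partial>S/\<partial>zbar = c(S) g\<close>. This is
  the content of \<open>solution_by_change_of_unknown\<close>; the remaining task is to bring \<open>f\<close> into a
  normal form \<open>c\<close> for which the transformed equation can be solved explicitly.

  If \<open>f(w\<^sub>0) \<noteq> 0\<close>, a primitive of \<open>1/f\<close> straightens \<open>f\<close> to the constant field \<open>c = 1\<close>, and \<open>S\<close>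
  can be \<open>G\<close> up to an additive constant. If \<open>G\<close> happens to be constant near \<open>z\<^sub>0\<close>, then
  adding the holomorphic function \<open>z\<close> to \<open>G\<close> changes nothing in the equation and makes \<open>S\<close>
  non-constant.

  If \<open>f(w\<^sub>0) = 0\<close>, simplicity of the zero gives a linearization \<open>c(s) = a s\<close> with
  \<open>a = f'(w\<^sub>0) \<noteq> 0\<close> (\<open>linearization_at_simple_zero\<close>). The linear equation
  \<open>\<partial>S/\<partial>zbar = a g S\<close> has the solution \<open>S(z) = (z - z\<^sub>0) exp(a G(z))\<close>; the factor \<open>z - z\<^sub>0\<close>
  makes it vanish at \<open>z\<^sub>0\<close>, as \<open>u(z\<^sub>0) = w\<^sub>0\<close> demands, without making it constant.

  The function \<open>G\<close> is only known to have partial derivatives at each point, so all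
  chain and product rules are applied along the two coordinate lines through a point.
\<close>

section \<open>Calculus of the pointwise zbar derivative\<close>

text \<open>
  Existence of the two partial derivatives and the value of their combination are bundled into
  one relation, so that each rule below transports both at once.
\<close>

definition has_dbar :: "(complex \<Rightarrow> complex) \<Rightarrow> complex \<Rightarrow> complex \<Rightarrow> bool" where
  "has_dbar v d z \<longleftrightarrow> (\<exists>p q.
     ((\<lambda>t::real. v (z + of_real t)) has_vector_derivative p) (at 0) \<and>
     ((\<lambda>t::real. v (z + \<i> * of_real t)) has_vector_derivative q) (at 0) \<and>
     d = (p + \<i> * q) / 2)"

lemma dbar_eq_on_iff_has_dbar: "dbar_eq_on v h S \<longleftrightarrow> (\<forall>z\<in>S. has_dbar v (h z) z)"
proof -
  have "has_partials_at v z \<and> dbar v z = d \<longleftrightarrow> has_dbar v d z" for z d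
    unfolding has_partials_at_def dbar_def has_dbar_def partial_x_def partial_y_def
    by (metis vector_derivative_works vector_derivative_at differentiableI_vector)
  then show ?thesis
    by (simp add: dbar_eq_on_def)
qed

lemma has_dbar_add:
  assumes "has_dbar v d z" and "has_dbar w e z"
  shows "has_dbar (\<lambda>z. v z + w z) (d + e) z"
proof -
  obtain p q where v:
      "((\<lambda>t::real. v (z + of_real t)) has_vector_derivative p) (at 0)"
      "((\<lambda>t::real. v (z + \<i> * of_real t)) has_vector_derivative q) (at 0)"
      "d = (p + \<i> * q) / 2"
    using assms(1) by (auto simp: has_dbar_def)
  obtain p' q' where w:
      "((\<lambda>t::real. w (z + of_real t)) has_vector_derivative p') (at 0)"
      "((\<lambda>t::real. w (z + \<i> * of_real t)) has_vector_derivative q') (at 0)"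
      "e = (p' + \<i> * q') / 2"
    using assms(2) by (auto simp: has_dbar_def)
  show ?thesis
    unfolding has_dbar_def
    using has_vector_derivative_add[OF v(1) w(1)] has_vector_derivative_add[OF v(2) w(2)]
    by (intro exI[of _ "p + p'"] exI[of _ "q + q'"])
       (simp add: v(3) w(3) field_simps)
qed

lemma has_dbar_mult:
  assumes "has_dbar v d z" and "has_dbar w e z"
  shows "has_dbar (\<lambda>z. v z * w z) (v z * e + d * w z) z"
proof -
  obtain p q where v:
      "((\<lambda>t::real. v (z + of_real t)) has_vector_derivative p) (at 0)"
      "((\<lambda>t::real. v (z + \<i> * of_real t)) has_vector_derivative q) (at 0)"
      "d = (p + \<i> * q) / 2"
    using assms(1) by (auto simp: has_dbar_def)
  obtain p' q' where w:
      "((\<lambda>t::real. w (z + of_real t)) has_vector_derivative p') (at 0)"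
      "((\<lambda>t::real. w (z + \<i> * of_real t)) has_vector_derivative q') (at 0)"
      "e = (p' + \<i> * q') / 2"
    using assms(2) by (auto simp: has_dbar_def)
  show ?thesis
    unfolding has_dbar_def
    using has_vector_derivative_mult[OF v(1) w(1)] has_vector_derivative_mult[OF v(2) w(2)]
    by (intro exI[of _ "v z * p' + p * w z"] exI[of _ "v z * q' + q * w z"])
       (simp add: v(3) w(3) field_simps)
qed

text \<open>
  The outer function has a complex-linear derivative, which commutes with the factor \<open>\<i>\<close> in the
  zbar derivative; hence no conjugate term appears.
\<close>

lemma has_dbar_chain:
  assumes "(\<phi> has_field_derivative D) (at (v z))" and "has_dbar v d z"
  shows "has_dbar (\<lambda>z. \<phi> (v z)) (D * d) z"
proof -
  obtain p q where v:
      "((\<lambda>t::real. v (z + of_real t)) has_vector_derivative p) (at 0)"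
      "((\<lambda>t::real. v (z + \<i> * of_real t)) has_vector_derivative q) (at 0)"
      "d = (p + \<i> * q) / 2"
    using assms(2) by (auto simp: has_dbar_def)
  show ?thesis
    unfolding has_dbar_def
    using field_vector_diff_chain_at[OF v(1), of \<phi> D] field_vector_diff_chain_at[OF v(2), of \<phi> D] assms(1)
    by (intro exI[of _ "p * D"] exI[of _ "q * D"])
       (simp add: v(3) field_simps o_def)
qed

lemma has_dbar_ident: "has_dbar (\<lambda>z. z) 0 z"
  unfolding has_dbar_def
  by (intro exI[of _ 1] exI[of _ \<i>] conjI)
     (auto intro!: derivative_eq_intros has_vector_derivative_real_field)

lemma has_dbar_const: "has_dbar (\<lambda>z. k) 0 z"
  unfolding has_dbar_def
  by (intro exI[of _ 0] conjI) auto

section \<open>Changing the unknown by a local biholomorphism\<close>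

text \<open>
  With \<open>\<phi> = \<psi>\<inverse>\<close> the hypothesis \<open>\<psi>' f = c \<circ> \<psi>\<close> turns into \<open>\<phi>' c = f \<circ> \<phi>\<close>, so the
  chain rule for \<open>u = \<phi> \<circ> S\<close> gives \<open>\<phi>'(S) c(S) g = f(u) g\<close>. Continuity of \<open>S\<close> is what keeps
  its values in the domain of \<open>\<phi>\<close> on a whole neighborhood of \<open>z\<^sub>0\<close>. As that neighborhood is not
  known in advance, \<open>S\<close> has to be non-constant on every one.
\<close>

lemma solution_by_change_of_unknown:
  fixes \<psi> S f g c :: "complex \<Rightarrow> complex"
  assumes "open \<Omega>" "z\<^sub>0 \<in> \<Omega>" "open B" "w\<^sub>0 \<in> B" "B \<subseteq> \<Omega>'"
    and hol: "\<psi> holomorphic_on B" and nz: "deriv \<psi> w\<^sub>0 \<noteq> 0"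
    and conj: "\<And>w. w \<in> B \<Longrightarrow> deriv \<psi> w * f w = c (\<psi> w)"
    and contS: "continuous_on \<Omega> S" and S0: "S z\<^sub>0 = \<psi> w\<^sub>0"
    and S: "\<And>z. z \<in> \<Omega> \<Longrightarrow> has_dbar S (c (S z) * g z) z"
    and nonconst: "\<And>U. open U \<Longrightarrow> z\<^sub>0 \<in> U \<Longrightarrow> U \<subseteq> \<Omega> \<Longrightarrow> \<not> S constant_on U"
  shows "\<exists>U u. open U \<and> z\<^sub>0 \<in> U \<and> U \<subseteq> \<Omega> \<and> continuous_on U u \<and> u ` U \<subseteq> \<Omega>' \<and>
           \<not> u constant_on U \<and> dbar_eq_on u (\<lambda>z. f (u z) * g z) U \<and> u z\<^sub>0 = w\<^sub>0"
proof -
  obtain r where r: "r > 0" "ball w\<^sub>0 r \<subseteq> B" "open (\<psi> ` ball w\<^sub>0 r)" "inj_on \<psi> (ball w\<^sub>0 r)"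
    using has_complex_derivative_locally_invertible[OF hol \<open>w\<^sub>0 \<in> B\<close> \<open>open B\<close> nz] by metis
  have hol': "\<psi> holomorphic_on ball w\<^sub>0 r"
    using hol r(2) holomorphic_on_subset by blast
  obtain \<phi> where \<phi>: "\<phi> holomorphic_on (\<psi> ` ball w\<^sub>0 r)"
      "\<And>w. w \<in> ball w\<^sub>0 r \<Longrightarrow> deriv \<psi> w * deriv \<phi> (\<psi> w) = 1"
      "\<And>w. w \<in> ball w\<^sub>0 r \<Longrightarrow> \<phi> (\<psi> w) = w"
    using holomorphic_has_inverse[OF hol' open_ball r(4)] by metis
  define U where "U = \<Omega> \<inter> S -` (\<psi> ` ball w\<^sub>0 r)"
  define u where "u = (\<lambda>z. \<phi> (S z))"
  have "open U"
    unfolding U_def using continuous_open_preimage[OF contS \<open>open \<Omega>\<close> r(3)] .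
  have "z\<^sub>0 \<in> U"
    using \<open>z\<^sub>0 \<in> \<Omega>\<close> S0 r(1) by (auto simp: U_def)
  have "U \<subseteq> \<Omega>"
    by (auto simp: U_def)
  have "continuous_on U u"
    unfolding u_def
  proof (rule continuous_on_compose2[where g = \<phi> and f = S])
    show "continuous_on (\<psi> ` ball w\<^sub>0 r) \<phi>"
      using \<phi>(1) by (rule holomorphic_on_imp_continuous_on)
    show "continuous_on U S"
      using contS \<open>U \<subseteq> \<Omega>\<close> continuous_on_subset by blast
  qed (auto simp: U_def)
  have inverse_on_U: "u z \<in> ball w\<^sub>0 r \<and> \<psi> (u z) = S z" if "z \<in> U" for z
    using that \<phi>(3) by (auto simp: U_def u_def)
  have "\<not> u constant_on U"
  proof
    assume "u constant_on U"
    then have "S constant_on U"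
      using inverse_on_U unfolding constant_on_def by metis
    then show False
      using nonconst[OF \<open>open U\<close> \<open>z\<^sub>0 \<in> U\<close> \<open>U \<subseteq> \<Omega>\<close>] by blast
  qed
  moreover have "has_dbar u (f (u z) * g z) z" if "z \<in> U" for z
  proof -
    define w where "w = u z"
    have w: "w \<in> ball w\<^sub>0 r" "\<psi> w = S z" "w \<in> B"
      using inverse_on_U[OF that] r(2) by (auto simp: w_def)
    have "(\<phi> has_field_derivative deriv \<phi> (S z)) (at (S z))"
      using holomorphic_derivI[OF \<phi>(1) r(3)] w by (metis imageI)
    moreover have "has_dbar S (c (S z) * g z) z"
      using S that \<open>U \<subseteq> \<Omega>\<close> by blast
    ultimately have "has_dbar u (deriv \<phi> (S z) * (c (S z) * g z)) z"
      unfolding u_def by (rule has_dbar_chain)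
    moreover have "deriv \<phi> (S z) * c (S z) = f w"
    proof -
      have "deriv \<phi> (S z) * c (S z) = (deriv \<psi> w * deriv \<phi> (\<psi> w)) * f w"
        using conj[OF w(3)] w(2) by (metis mult.commute mult.assoc)
      then show ?thesis
        using \<phi>(2)[OF w(1)] by simp
    qed
    ultimately show ?thesis
      by (simp add: w_def flip: mult.assoc)
  qed
  moreover have "u ` U \<subseteq> \<Omega>'"
    using inverse_on_U r(2) \<open>B \<subseteq> \<Omega>'\<close> by blast
  ultimately show ?thesis
    using \<open>open U\<close> \<open>z\<^sub>0 \<in> U\<close> \<open>U \<subseteq> \<Omega>\<close> \<open>continuous_on U u\<close> r(1) \<phi>(3) S0
    by (intro exI[of _ U] exI[of _ u]) (auto simp: dbar_eq_on_iff_has_dbar u_def)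
qed

section \<open>Normal forms of a holomorphic vector field at a point\<close>

lemma straightening_at_nonzero:
  fixes f :: "complex \<Rightarrow> complex"
  assumes "f holomorphic_on \<Omega>" "open \<Omega>" "w\<^sub>0 \<in> \<Omega>" "f w\<^sub>0 \<noteq> 0"
  obtains r \<psi> where "r > 0" "ball w\<^sub>0 r \<subseteq> \<Omega>" "\<psi> holomorphic_on ball w\<^sub>0 r"
    "\<And>w. w \<in> ball w\<^sub>0 r \<Longrightarrow> deriv \<psi> w * f w = 1"
proof -
  have "continuous_on \<Omega> f"
    using assms(1) by (rule holomorphic_on_imp_continuous_on)
  then have "open (\<Omega> \<inter> f -` (- {0}))"
    using assms(2) by (intro continuous_open_preimage) auto
  then obtain r where r: "r > 0" "ball w\<^sub>0 r \<subseteq> \<Omega> \<inter> f -` (- {0})"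
    using assms(3,4) by (metis open_contains_ball IntI vimageI ComplI singletonD)
  have "(\<lambda>w. 1 / f w) holomorphic_on ball w\<^sub>0 r"
    using r(2) by (intro holomorphic_intros holomorphic_on_subset[OF assms(1)]) auto
  then obtain \<psi> where \<psi>: "\<And>w. w \<in> ball w\<^sub>0 r \<Longrightarrow> (\<psi> has_field_derivative 1 / f w) (at w)"
    by (metis holomorphic_convex_primitive' convex_ball open_ball at_within_open)
  show ?thesis
  proof (rule that[OF r(1)])
    show "\<psi> holomorphic_on ball w\<^sub>0 r"
      using \<psi> holomorphic_on_open[OF open_ball] by blast
    show "deriv \<psi> w * f w = 1" if "w \<in> ball w\<^sub>0 r" for w
      using DERIV_imp_deriv[OF \<psi>[OF that]] r(2) that by auto
  qed (use r in auto)
qed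

lemma simple_zero_factorization:
  assumes "simple_zero f w\<^sub>0" "f holomorphic_on \<Omega>" "open \<Omega>" "w\<^sub>0 \<in> \<Omega>"
  obtains r k where "r > 0" "ball w\<^sub>0 r \<subseteq> \<Omega>" "k holomorphic_on ball w\<^sub>0 r"
    "\<And>w. w \<in> ball w\<^sub>0 r \<Longrightarrow> f w = k w * (w - w\<^sub>0)"
    "\<And>w. w \<in> ball w\<^sub>0 r \<Longrightarrow> k w \<noteq> 0"
proof -
  obtain e where e: "e > 0" "ball w\<^sub>0 e \<subseteq> \<Omega>"
    using assms(3,4) open_contains_ball by blast
  have hol: "f holomorphic_on ball w\<^sub>0 e"
    using assms(2) e(2) holomorphic_on_subset by blast
  have "eventually (\<lambda>w. f w \<noteq> 0) (at w\<^sub>0)"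
    using assms(1) by (auto simp: simple_zero_def isolated_zero_def)
  moreover have "eventually (\<lambda>w. w \<in> ball w\<^sub>0 e) (at w\<^sub>0)"
    using e(1) by (intro eventually_at_in_open') auto
  ultimately have "\<exists>w. f w \<noteq> 0 \<and> w \<in> ball w\<^sub>0 e"
    by (intro eventually_happens'[of "at w\<^sub>0"] eventually_conj) auto
  then have "\<exists>w\<in>ball w\<^sub>0 e. f w \<noteq> 0"
    by blast
  from zorder_exist_zero[OF hol open_ball connected_ball _ this] e(1)
  obtain r where r: "r > 0" "cball w\<^sub>0 r \<subseteq> ball w\<^sub>0 e" "zor_poly f w\<^sub>0 holomorphic_on cball w\<^sub>0 r"
      "\<forall>w\<in>cball w\<^sub>0 r. f w = zor_poly f w\<^sub>0 w * (w - w\<^sub>0) ^ nat (zorder f w\<^sub>0) \<and> zor_poly f w\<^sub>0 w \<noteq> 0"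
    using assms(1) centre_in_ball by blast
  have sub: "ball w\<^sub>0 r \<subseteq> cball w\<^sub>0 r"
    by (rule ball_subset_cball)
  show ?thesis
  proof (rule that[of r "zor_poly f w\<^sub>0"])
    show "ball w\<^sub>0 r \<subseteq> \<Omega>"
      using sub r(2) e(2) by blast
    show "zor_poly f w\<^sub>0 holomorphic_on ball w\<^sub>0 r"
      using r(3) sub holomorphic_on_subset by blast
  qed (use r(1,4) assms(1) in \<open>auto simp: simple_zero_def\<close>)
qed

text \<open>
  The linearizing coordinate has to satisfy \<open>\<psi>'/\<psi> = a/f\<close>. Simplicity of the zero and
  \<open>a = f'(w\<^sub>0)\<close> make \<open>a/f\<close> have a simple pole with residue one, so \<open>a/f - 1/(w - w\<^sub>0)\<close> extends to
  a holomorphic function with a primitive \<open>H\<close>, and \<open>\<psi>(w) = (w - w\<^sub>0) exp(H(w))\<close>.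
\<close>

lemma linearization_at_simple_zero:
  assumes "simple_zero f w\<^sub>0" "f holomorphic_on \<Omega>" "open \<Omega>" "w\<^sub>0 \<in> \<Omega>"
  obtains r a \<psi> where "r > 0" "ball w\<^sub>0 r \<subseteq> \<Omega>" "\<psi> holomorphic_on ball w\<^sub>0 r"
    "\<psi> w\<^sub>0 = 0" "deriv \<psi> w\<^sub>0 \<noteq> 0"
    "\<And>w. w \<in> ball w\<^sub>0 r \<Longrightarrow> deriv \<psi> w * f w = a * \<psi> w"
proof -
  obtain r k where r: "r > 0" "ball w\<^sub>0 r \<subseteq> \<Omega>"
    and k: "k holomorphic_on ball w\<^sub>0 r"
      "\<And>w. w \<in> ball w\<^sub>0 r \<Longrightarrow> f w = k w * (w - w\<^sub>0)"
      "\<And>w. w \<in> ball w\<^sub>0 r \<Longrightarrow> k w \<noteq> 0"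
    using simple_zero_factorization[OF assms] by metis
  define a where "a = k w\<^sub>0"
  define q where "q = (\<lambda>w. a / k w)"
  define h where "h = (\<lambda>w. if w = w\<^sub>0 then deriv q w\<^sub>0 else (q w - q w\<^sub>0) / (w - w\<^sub>0))"
  have q0: "q w\<^sub>0 = 1"
    using k(3) r(1) by (simp add: q_def a_def)
  have "q holomorphic_on ball w\<^sub>0 r"
    unfolding q_def using k(1,3) by (intro holomorphic_intros)
  then have "h holomorphic_on ball w\<^sub>0 r"
    unfolding h_def by (intro pole_lemma_open) auto
  then obtain H where H: "\<And>w. w \<in> ball w\<^sub>0 r \<Longrightarrow> (H has_field_derivative h w) (at w)"
    by (metis holomorphic_convex_primitive' convex_ball open_ball at_within_open)
  \<comment> \<open>This identity also holds at \<open>w\<^sub>0\<close>, so \<open>\<psi>'\<close> below needs no separate treatment there.\<close>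
  have q_eq: "1 + (w - w\<^sub>0) * h w = q w" for w
    by (simp add: h_def q0)
  define \<psi> where "\<psi> = (\<lambda>w. (w - w\<^sub>0) * exp (H w))"
  have \<psi>': "(\<psi> has_field_derivative exp (H w) * q w) (at w)" if "w \<in> ball w\<^sub>0 r" for w
    unfolding \<psi>_def q_eq[symmetric]
    by (rule derivative_eq_intros H[OF that] refl)+ (simp add: algebra_simps)
  have deriv_\<psi>: "deriv \<psi> w = exp (H w) * q w" if "w \<in> ball w\<^sub>0 r" for w
    using DERIV_imp_deriv[OF \<psi>'[OF that]] .
  show ?thesis
  proof (rule that[of r \<psi> a])
    show "\<psi> holomorphic_on ball w\<^sub>0 r"
      using \<psi>' holomorphic_on_open[OF open_ball] by blast
    show "\<psi> w\<^sub>0 = 0"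
      by (simp add: \<psi>_def)
    show "deriv \<psi> w\<^sub>0 \<noteq> 0"
      using deriv_\<psi>[of w\<^sub>0] r(1) q0 by simp
    show "deriv \<psi> w * f w = a * \<psi> w" if "w \<in> ball w\<^sub>0 r" for w
      using k(2,3)[OF that] unfolding deriv_\<psi>[OF that] by (simp add: q_def \<psi>_def)
  qed (use r in auto)
qed

section \<open>Solving the equation\<close>

lemma open_set_has_other_point:
  fixes z :: complex
  assumes "open U" "z \<in> U"
  obtains z' where "z' \<in> U" "z' \<noteq> z"
  using assms not_open_singleton[of z] by (metis subsetI subset_singletonD empty_iff insertI1)

text \<open>
  A potential that is constant near \<open>z\<^sub>0\<close> is replaced by its sum with \<open>z\<close>, which is annihilated by
  the zbar derivative and non-constant on every neighborhood of \<open>z\<^sub>0\<close>.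
\<close>

lemma non_constant_potential:
  assumes "open \<Omega>" "z\<^sub>0 \<in> \<Omega>" "continuous_on \<Omega> G" "dbar_eq_on G g \<Omega>"
  obtains K where "continuous_on \<Omega> K" "dbar_eq_on K g \<Omega>"
    "\<And>U. open U \<Longrightarrow> z\<^sub>0 \<in> U \<Longrightarrow> U \<subseteq> \<Omega> \<Longrightarrow> \<not> K constant_on U"
proof (cases "\<exists>V. open V \<and> z\<^sub>0 \<in> V \<and> G constant_on V")
  case True
  then obtain V b where V: "open V" "z\<^sub>0 \<in> V" "\<And>z. z \<in> V \<Longrightarrow> G z = b"
    by (auto simp: constant_on_def)
  show ?thesis
  proof (rule that[of "\<lambda>z. G z + z"])
    show "continuous_on \<Omega> (\<lambda>z. G z + z)"
      using assms(3) by (intro continuous_intros)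
    show "dbar_eq_on (\<lambda>z. G z + z) g \<Omega>"
      using assms(4) has_dbar_add[OF _ has_dbar_ident, of G]
      by (fastforce simp: dbar_eq_on_iff_has_dbar)
    show "\<not> (\<lambda>z. G z + z) constant_on U" if U: "open U" "z\<^sub>0 \<in> U" for U
    proof
      assume "(\<lambda>z. G z + z) constant_on U"
      then obtain c where c: "\<And>z. z \<in> U \<Longrightarrow> G z + z = c"
        by (auto simp: constant_on_def)
      obtain z' where z': "z' \<in> U \<inter> V" "z' \<noteq> z\<^sub>0"
        by (rule open_set_has_other_point[of "U \<inter> V" z\<^sub>0]) (use V(1,2) U in auto)
      have "G z\<^sub>0 = b" "G z' = b" "G z\<^sub>0 + z\<^sub>0 = c" "G z' + z' = c"
        using V(2,3) c U(2) z'(1) by auto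
      then have "z' = z\<^sub>0"
        by (metis add_left_cancel)
      with z'(2) show False ..
    qed
  qed
next
  case False
  then show ?thesis
    using that assms(3,4) by blast
qed

theorem theorem4p7:
  fixes \<Omega>\<^sub>1 \<Omega>\<^sub>2 :: "complex set"
    and f g :: "complex \<Rightarrow> complex"
    and z\<^sub>0 w\<^sub>0 :: complex
  assumes "open \<Omega>\<^sub>1" and "open \<Omega>\<^sub>2"
    and "f holomorphic_on \<Omega>\<^sub>2"
    and "\<And>w. w \<in> \<Omega>\<^sub>2 \<Longrightarrow> f w = 0 \<Longrightarrow> simple_zero f w"
    and "z\<^sub>0 \<in> \<Omega>\<^sub>1" and "w\<^sub>0 \<in> \<Omega>\<^sub>2"
    and "\<exists>G. continuous_on \<Omega>\<^sub>1 G \<and> dbar_eq_on G g \<Omega>\<^sub>1"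
  shows "\<exists>U u. open U \<and> z\<^sub>0 \<in> U \<and> U \<subseteq> \<Omega>\<^sub>1 \<and>
           continuous_on U u \<and> u ` U \<subseteq> \<Omega>\<^sub>2 \<and> \<not> u constant_on U \<and>
           dbar_eq_on u (\<lambda>z. f (u z) * g z) U \<and> u z\<^sub>0 = w\<^sub>0"
proof -
  obtain G where G: "continuous_on \<Omega>\<^sub>1 G" "dbar_eq_on G g \<Omega>\<^sub>1"
    using assms(7) by blast
  show ?thesis
  proof (cases "f w\<^sub>0 = 0")
    case False
    obtain r \<psi> where \<psi>: "r > 0" "ball w\<^sub>0 r \<subseteq> \<Omega>\<^sub>2" "\<psi> holomorphic_on ball w\<^sub>0 r"
        "\<And>w. w \<in> ball w\<^sub>0 r \<Longrightarrow> deriv \<psi> w * f w = 1"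
      using straightening_at_nonzero[OF assms(3,2,6) False] by metis
    obtain K where K: "continuous_on \<Omega>\<^sub>1 K" "dbar_eq_on K g \<Omega>\<^sub>1"
        "\<And>U. open U \<Longrightarrow> z\<^sub>0 \<in> U \<Longrightarrow> U \<subseteq> \<Omega>\<^sub>1 \<Longrightarrow> \<not> K constant_on U"
      using non_constant_potential[OF assms(1,5) G] by metis
    \<comment> \<open>The additive constant places \<open>S(z\<^sub>0)\<close> at \<open>\<psi>(w\<^sub>0)\<close>, which gives \<open>u(z\<^sub>0) = w\<^sub>0\<close>.\<close>
    define S where "S = (\<lambda>z. K z + (\<psi> w\<^sub>0 - K z\<^sub>0))"
    show ?thesis
    proof (rule solution_by_change_of_unknown[where \<psi> = \<psi> and S = S and c = "\<lambda>_. 1"])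
      show "deriv \<psi> w\<^sub>0 \<noteq> 0"
        using \<psi>(4)[of w\<^sub>0] \<psi>(1) by auto
      show "continuous_on \<Omega>\<^sub>1 S"
        unfolding S_def using K(1) by (intro continuous_intros)
      show "has_dbar S (1 * g z) z" if "z \<in> \<Omega>\<^sub>1" for z
        using has_dbar_add[OF _ has_dbar_const, of K "g z" z] K(2) that
        by (simp add: dbar_eq_on_iff_has_dbar S_def)
      show "\<not> S constant_on U" if "open U" "z\<^sub>0 \<in> U" "U \<subseteq> \<Omega>\<^sub>1" for U
        using K(3)[OF that] unfolding constant_on_def S_def by (metis add_right_cancel)
    qed (use assms(1,5) \<psi> in \<open>auto simp: S_def\<close>)
  next
    case True
    obtain r a \<psi> where \<psi>: "r > 0" "ball w\<^sub>0 r \<subseteq> \<Omega>\<^sub>2" "\<psi> holomorphic_on ball w\<^sub>0 r"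
        "\<psi> w\<^sub>0 = 0" "deriv \<psi> w\<^sub>0 \<noteq> 0"
        "\<And>w. w \<in> ball w\<^sub>0 r \<Longrightarrow> deriv \<psi> w * f w = a * \<psi> w"
      using linearization_at_simple_zero[OF assms(4)[OF assms(6) True] assms(3,2,6)] by metis
    define S where "S = (\<lambda>z. (z - z\<^sub>0) * exp (a * G z))"
    show ?thesis
    proof (rule solution_by_change_of_unknown[where \<psi> = \<psi> and S = S and c = "\<lambda>s. a * s"])
      show "continuous_on \<Omega>\<^sub>1 S"
        unfolding S_def using G(1) by (intro continuous_intros)
      show "has_dbar S (a * S z * g z) z" if "z \<in> \<Omega>\<^sub>1" for z
      proof -
        have "((\<lambda>s. exp (a * s)) has_field_derivative exp (a * G z) * a) (at (G z))"
          by (auto intro!: derivative_eq_intros)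
        moreover have "has_dbar G (g z) z"
          using G(2) that by (simp add: dbar_eq_on_iff_has_dbar)
        ultimately have "has_dbar (\<lambda>z. exp (a * G z)) (exp (a * G z) * a * g z) z"
          by (rule has_dbar_chain)
        moreover have "has_dbar (\<lambda>z. z - z\<^sub>0) 0 z"
          using has_dbar_add[OF has_dbar_ident has_dbar_const, of "- z\<^sub>0" z] by simp
        ultimately show ?thesis
          unfolding S_def using has_dbar_mult by (fastforce simp: mult_ac)
      qed
      show "\<not> S constant_on U" if "open U" "z\<^sub>0 \<in> U" for U
      proof
        assume const: "S constant_on U"
        obtain z' where z': "z' \<in> U" "z' \<noteq> z\<^sub>0"
          using open_set_has_other_point \<open>open U\<close> \<open>z\<^sub>0 \<in> U\<close> by blast
        have "S z' = S z\<^sub>0"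
          using const z'(1) \<open>z\<^sub>0 \<in> U\<close> unfolding constant_on_def by metis
        with z'(2) show False
          by (simp add: S_def)
      qed
    qed (use assms(1,5) \<psi> in \<open>auto simp: S_def\<close>)
  qed
qed

end
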